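(* Let $N\ge1$. For any nonempty bounded set $\mathscr{A}$ of non-negative real $N\times N$ matrices, $\check{\rho}(\mathscr{A})=\check{\rho}(\operatorname{co}(\mathscr{A}))$, where $\operatorname{co}(\mathscr{A})$ is the convex hull of $\mathscr{A}$ and $\check{\rho}$ is the lower spectral radius.
   Context: A matrix is non-negative if all its entries are $\ge 0$. The lower spectral radius (joint spectral subradius) of a set $\mathscr{S}$ of real $N\times N$ matrices is $$\check{\rho}(\mathscr{S})=\lim_{n\to\infty}\inf_{A_i\in\mathscr{S}}\|A_n\cdots A_1\|^{1/n}=\inf_{n\ge1}\inf_{A_i\in\mathscr{S}}\|A_n\cdots A_1\|^{1/n},$$ where $\|\cdot\|$ is a matrix norm induced by a vector norm on $\mathbb{R}^N$. It is known that for an arbitrary set $\mathscr{S}$ one also has $\check{\rho}(\mathscr{S})=\lim_{n\to\infty}\inf_{A_i\in\mathscr{S}}\rho(A_n\cdots A_1)^{1/n}=\inf_{n\ge1}\inf_{A_i\in\mathscr{S}}\rho(A_n\cdots A_1)^{1/n}$, where $\rho(\cdot)$ is the spectral radius of a matrix. *)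

theory Defs
  imports "HOL-Analysis.Analysis"
begin

definition vector_norm :: "('a::real_vector \<Rightarrow> real) \<Rightarrow> bool" where
  "vector_norm \<nu> \<longleftrightarrow>
     (\<forall>x. 0 \<le> \<nu> x) \<and>
     (\<forall>x. \<nu> x = 0 \<longleftrightarrow> x = 0) \<and>
     (\<forall>c x. \<nu> (c *\<^sub>R x) = \<bar>c\<bar> * \<nu> x) \<and>
     (\<forall>x y. \<nu> (x + y) \<le> \<nu> x + \<nu> y)"

definition induced_norm :: "(real ^ 'n \<Rightarrow> real) \<Rightarrow> real ^ 'n ^ 'n \<Rightarrow> real" where
  "induced_norm \<nu> A = (SUP x\<in>{x. x \<noteq> 0}. \<nu> (A *v x) / \<nu> x)"

primrec matrix_prod :: "(nat \<Rightarrow> real ^ 'n ^ 'n) \<Rightarrow> nat \<Rightarrow> real ^ 'n ^ 'n" where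
  "matrix_prod A 0 = mat 1"
| "matrix_prod A (Suc n) = A (Suc n) ** matrix_prod A n"

definition inf_root_norm :: "(real ^ 'n \<Rightarrow> real) \<Rightarrow> (real ^ 'n ^ 'n) set \<Rightarrow> nat \<Rightarrow> real" where
  "inf_root_norm \<nu> S n =
     (INF A\<in>{A. \<forall>i\<in>{1..n}. A i \<in> S}. root n (induced_norm \<nu> (matrix_prod A n)))"

text \<open>
  The constant \<^term>\<open>lim\<close> has an unspecified value on divergent sequences; the lemmas
  \<open>inf_root_norm_LIMSEQ\<close> and \<open>lower_spectral_radius_eq_INF\<close> below show that for
  nonempty \<open>S\<close> the limit exists and equals the infimum over \<open>n \<ge> 1\<close>.
\<close>

definition lower_spectral_radius :: "(real ^ 'n \<Rightarrow> real) \<Rightarrow> (real ^ 'n ^ 'n) set \<Rightarrow> real" where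
  "lower_spectral_radius \<nu> S = lim (inf_root_norm \<nu> S)"

lemma vector_norm_bounds:
  fixes \<nu> :: "real ^ 'n \<Rightarrow> real"
  assumes "vector_norm \<nu>"
  obtains c C where "c > 0" "C > 0" "\<And>x. c * norm x \<le> \<nu> x" "\<And>x. \<nu> x \<le> C * norm x"
proof -
  have nn: "0 \<le> \<nu> x" and eq0: "\<nu> x = 0 \<longleftrightarrow> x = 0"
    and sc: "\<nu> (c *\<^sub>R x) = \<bar>c\<bar> * \<nu> x" and tri: "\<nu> (x + y) \<le> \<nu> x + \<nu> y" for c x y
    using assms by (auto simp: vector_norm_def)
  define C where "C = (\<Sum>b\<in>Basis. \<nu> b) + 1"
  have sumle: "\<nu> (sum f B) \<le> (\<Sum>b\<in>B. \<nu> (f b))" if "finite B" for f :: "real^'n \<Rightarrow> real^'n" and B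
    using that
  proof induction
    case empty then show ?case using eq0[of 0] by simp
  next
    case (insert b B) then show ?case using tri[of "f b" "sum f B"] by simp
  qed
  have up: "\<nu> x \<le> C * norm x" for x
  proof -
    have "\<nu> x = \<nu> (\<Sum>b\<in>Basis. (x \<bullet> b) *\<^sub>R b)" by (simp add: euclidean_representation)
    also have "\<dots> \<le> (\<Sum>b\<in>Basis. \<nu> ((x \<bullet> b) *\<^sub>R b))" by (rule sumle) simp
    also have "\<dots> \<le> (\<Sum>b\<in>Basis. norm x * \<nu> b)"
      by (intro sum_mono) (simp add: sc mult_right_mono nn Basis_le_norm)
    also have "\<dots> \<le> C * norm x" by (simp add: C_def sum_distrib_left algebra_simps)
    finally show ?thesis .
  qed
  have Cpos: "C > 0" using nn unfolding C_def by (simp add: add_nonneg_pos sum_nonneg)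
  have neg: "\<nu> (- x) = \<nu> x" for x using sc[of "-1" x] by simp
  have lip: "\<bar>\<nu> x - \<nu> y\<bar> \<le> C * dist x y" for x y
    using tri[of "x - y" y] tri[of "y - x" x] up[of "x - y"] neg[of "x - y"]
    by (auto simp: dist_norm)
  have "continuous_on (sphere 0 1) \<nu>"
  proof (rule lipschitz_on_continuous_on)
    show "C-lipschitz_on (sphere 0 1) \<nu>"
      using lip Cpos by (intro lipschitz_onI) (auto simp: dist_real_def)
  qed
  moreover have "sphere (0::real^'n) 1 \<noteq> {}" by simp
  ultimately obtain u where u: "u \<in> sphere 0 1" "\<And>y. y \<in> sphere 0 1 \<Longrightarrow> \<nu> u \<le> \<nu> y"
    using continuous_attains_inf[of "sphere 0 1" \<nu>] by (metis compact_sphere)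
  have "\<nu> u > 0" using u(1) eq0[of u] nn[of u] by (auto simp: less_le)
  moreover have "\<nu> u * norm x \<le> \<nu> x" for x
  proof (cases "x = 0")
    case False
    have "\<nu> u \<le> \<nu> ((1 / norm x) *\<^sub>R x)" using False by (intro u(2)) simp
    then show ?thesis using False by (simp add: sc field_simps)
  qed (simp add: nn)
  ultimately show ?thesis using that Cpos up by blast
qed

lemma
  fixes \<nu> :: "real ^ 'n \<Rightarrow> real"
  assumes "vector_norm \<nu>"
  shows induced_norm_bdd: "bdd_above ((\<lambda>x. \<nu> (A *v x) / \<nu> x) ` {x. x \<noteq> 0})"
    and induced_norm_nonneg: "0 \<le> induced_norm \<nu> A"
    and induced_norm_le: "\<nu> (A *v x) \<le> induced_norm \<nu> A * \<nu> x"
    and induced_norm_mult: "induced_norm \<nu> (A ** B) \<le> induced_norm \<nu> A * induced_norm \<nu> B"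
proof -
  have nn: "0 \<le> \<nu> x" and eq0: "\<nu> x = 0 \<longleftrightarrow> x = 0" for x
    using assms by (auto simp: vector_norm_def)
  have pos: "\<nu> x > 0" if "x \<noteq> 0" for x using nn[of x] eq0[of x] that by linarith
  obtain c C where cC: "c > 0" "C > 0" "\<And>x. c * norm x \<le> \<nu> x" "\<And>x. \<nu> x \<le> C * norm x"
    using vector_norm_bounds[OF assms] by blast
  have bdd: "bdd_above ((\<lambda>x. \<nu> (M *v x) / \<nu> x) ` {x. x \<noteq> 0})" for M
  proof (rule bdd_aboveI2)
    fix x :: "real^'n" assume "x \<in> {x. x \<noteq> 0}"
    then have x: "x \<noteq> 0" by simp
    have "\<nu> (M *v x) \<le> C * (onorm ((*v) M) * norm x)"
      using cC(2) cC(4)[of "M *v x"] onorm[of "(*v) M" x]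
      by (meson matrix_vector_mul_bounded_linear mult_left_mono order_trans less_imp_le)
    also have "\<dots> \<le> C * (onorm ((*v) M) * (\<nu> x / c))"
      using cC(1,2) cC(3)[of x]
      by (intro mult_left_mono) (auto simp: field_simps onorm_pos_le)
    finally show "\<nu> (M *v x) / \<nu> x \<le> C * onorm ((*v) M) / c"
      using pos[OF x] cC(1) by (simp add: field_simps)
  qed
  have le: "\<nu> (M *v x) / \<nu> x \<le> induced_norm \<nu> M" if "x \<noteq> 0" for M x
    unfolding induced_norm_def by (rule cSUP_upper[OF _ bdd]) (use that in simp)
  have nn': "0 \<le> induced_norm \<nu> M" for M
    using le[of "axis undefined 1" M] nn
    by (metis axis_eq_0_iff divide_nonneg_nonneg order_trans zero_neq_one)
  have le': "\<nu> (M *v x) \<le> induced_norm \<nu> M * \<nu> x" for M x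
    using le[of x M] pos[of x] nn'[of M] nn[of x] eq0[of "0::real^'n"]
    by (cases "x = 0") (auto simp: field_simps)
  show "bdd_above ((\<lambda>x. \<nu> (A *v x) / \<nu> x) ` {x. x \<noteq> 0})" by (rule bdd)
  show "0 \<le> induced_norm \<nu> A" by (rule nn')
  show "\<nu> (A *v x) \<le> induced_norm \<nu> A * \<nu> x" by (rule le')
  show "induced_norm \<nu> (A ** B) \<le> induced_norm \<nu> A * induced_norm \<nu> B"
  proof (subst induced_norm_def, rule cSUP_least)
    show "{x::real^'n. x \<noteq> 0} \<noteq> {}"
      using axis_eq_0_iff[of undefined "1::real"] by fastforce
    fix x :: "real^'n" assume "x \<in> {x. x \<noteq> 0}"
    then have x: "x \<noteq> 0" by simp
    have "\<nu> (A *v (B *v x)) \<le> induced_norm \<nu> A * (induced_norm \<nu> B * \<nu> x)"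
      using le'[of A "B *v x"] le'[of B x] nn'[of A] by (meson mult_left_mono order_trans)
    then show "\<nu> (A ** B *v x) / \<nu> x \<le> induced_norm \<nu> A * induced_norm \<nu> B"
      using pos[OF x] by (simp add: matrix_vector_mul_assoc field_simps)
  qed
qed

lemma matrix_prod_cong:
  "(\<And>i. i \<in> {1..n} \<Longrightarrow> A i = B i) \<Longrightarrow> matrix_prod A n = matrix_prod B n"
  by (induction n) auto

lemma matrix_prod_add:
  "matrix_prod A (m + n) = matrix_prod (\<lambda>i. A (i + m)) n ** matrix_prod A m"
  by (induction n) (auto simp: matrix_mul_assoc add.commute)

lemma submultiplicative_root_LIMSEQ:
  fixes b :: "nat \<Rightarrow> real"
  assumes nn: "\<And>n. 0 \<le> b n" and sub: "\<And>m n. b (m + n) \<le> b m * b n"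
  shows "(\<lambda>n. root n (b n)) \<longlonglongrightarrow> (INF n\<in>{1..}. root n (b n))"
proof -
  define L where "L = (INF n\<in>{1..}. root n (b n))"
  have bdd: "bdd_below ((\<lambda>n. root n (b n)) ` {1..})"
    by (rule bdd_belowI2[of _ 0]) (simp add: nn real_root_ge_zero)
  have L_le: "L \<le> root n (b n)" if "n \<ge> 1" for n
    unfolding L_def using that by (intro cINF_lower bdd) auto
  have L0: "0 \<le> L"
    unfolding L_def by (rule cINF_greatest) (auto simp: nn real_root_ge_zero)
  have ev: "\<forall>\<^sub>F n in sequentially. root n (b n) < a" if a: "L < a" for a
  proof -
    obtain k where k: "k \<ge> 1" "root k (b k) < a"
      using a cINF_less_iff[OF _ bdd, of a] unfolding L_def by auto
    obtain t where t: "root k (b k) < t" "t < a" using dense[OF k(2)] by blast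
    have t0: "t > 0" using t(1) real_root_ge_zero[OF nn[of k], of k] by linarith
    have bk: "b k \<le> t ^ k"
      using t(1) k(1) nn[of k] power_mono[of "root k (b k)" t k] real_root_ge_zero[OF nn[of k], of k]
      by simp
    have bq: "b (q * k + r) \<le> t ^ (q * k) * b r" for q r
    proof (induction q)
      case (Suc q)
      have "b (Suc q * k + r) \<le> b k * b (q * k + r)" using sub[of k "q * k + r"] by (simp add: add.assoc)
      also have "\<dots> \<le> t ^ k * (t ^ (q * k) * b r)"
        using bk Suc nn t0 by (intro mult_mono) auto
      finally show ?case by (simp add: power_add mult.assoc)
    qed simp
    define K where "K = (\<Sum>r<k. b r / t ^ r) + 1"
    have K1: "K \<ge> 1" unfolding K_def using nn t0 by (simp add: sum_nonneg)
    have bn: "b n \<le> K * t ^ n" for n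
    proof -
      have r: "n mod k < k" using k(1) by simp
      have "b (n mod k) / t ^ (n mod k) \<le> (\<Sum>r<k. b r / t ^ r)"
        by (rule member_le_sum[of _ _ "\<lambda>r. b r / t ^ r"]) (use r nn t0 in auto)
      then have "b (n mod k) \<le> K * t ^ (n mod k)"
        using t0 by (simp add: K_def field_simps add_increasing)
      then have "t ^ (n div k * k) * b (n mod k) \<le> t ^ (n div k * k) * (K * t ^ (n mod k))"
        using t0 by (intro mult_left_mono) auto
      also have "\<dots> = K * t ^ (n div k * k + n mod k)"
        by (simp only: power_add mult.left_commute)
      finally show ?thesis using bq[of "n div k" "n mod k"] by simp
    qed
    have "(\<lambda>n. root n K * t) \<longlonglongrightarrow> 1 * t"
      using K1 by (intro tendsto_mult LIMSEQ_root_const tendsto_const) auto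
    then have "\<forall>\<^sub>F n in sequentially. root n K * t < a"
      using t(2) by (auto dest: order_tendstoD(2))
    then show ?thesis using eventually_gt_at_top[of 0]
    proof eventually_elim
      case (elim n)
      have "root n (b n) \<le> root n (K * t ^ n)" using bn elim by simp
      also have "\<dots> = root n K * t" using elim t0 by (simp add: real_root_mult real_root_power_cancel)
      finally show ?case using elim by simp
    qed
  qed
  have "(\<lambda>n. root n (b n)) \<longlonglongrightarrow> L"
  proof (rule order_tendstoI)
    fix a assume a: "a < L"
    show "\<forall>\<^sub>F n in sequentially. a < root n (b n)"
      using eventually_ge_at_top[of 1] by eventually_elim (use L_le a in fastforce)
  qed (rule ev)
  then show ?thesis unfolding L_def .
qed

lemma inf_root_norm_LIMSEQ:
  fixes \<nu> :: "real ^ 'n \<Rightarrow> real"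
  assumes \<nu>: "vector_norm \<nu>" and S: "S \<noteq> {}"
  shows "inf_root_norm \<nu> S \<longlonglongrightarrow> (INF n\<in>{1..}. inf_root_norm \<nu> S n)"
proof -
  define W where "W n = {A. \<forall>i\<in>{1..n}. A i \<in> S}" for n :: nat
  define b where "b n = (INF A\<in>W n. induced_norm \<nu> (matrix_prod A n))" for n
  obtain M where M: "M \<in> S" using S by blast
  have W: "W n \<noteq> {}" for n using M by (auto simp: W_def intro!: exI[of _ "\<lambda>_. M"])
  have bdd: "bdd_below ((\<lambda>A. induced_norm \<nu> (matrix_prod A n)) ` W n)" for n
    by (rule bdd_belowI2[of _ 0]) (rule induced_norm_nonneg[OF \<nu>])
  have b0: "0 \<le> b n" for n
    unfolding b_def by (rule cINF_greatest[OF W]) (rule induced_norm_nonneg[OF \<nu>])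
  have le1: "b (m + n) \<le> induced_norm \<nu> (matrix_prod A m) * induced_norm \<nu> (matrix_prod B n)"
    if A: "A \<in> W m" and B: "B \<in> W n" for A B m n
  proof -
    define D where "D i = (if i \<le> m then A i else B (i - m))" for i
    have D: "D \<in> W (m + n)"
      using A B unfolding W_def D_def by (auto simp: Ball_def Suc_le_eq)
    have "b (m + n) \<le> induced_norm \<nu> (matrix_prod D (m + n))"
      unfolding b_def by (rule cINF_lower[OF bdd D])
    also have "matrix_prod D (m + n) = matrix_prod B n ** matrix_prod A m"
      unfolding matrix_prod_add
      by (intro arg_cong2[where f = "(**)"] matrix_prod_cong) (auto simp: D_def)
    also have "induced_norm \<nu> \<dots> \<le> induced_norm \<nu> (matrix_prod B n) * induced_norm \<nu> (matrix_prod A m)"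
      by (rule induced_norm_mult[OF \<nu>])
    finally show ?thesis by (simp add: mult.commute)
  qed
  have INF_scale: "x \<le> c * b n"
    if c: "0 \<le> c" and x: "\<And>A. A \<in> W n \<Longrightarrow> x \<le> c * induced_norm \<nu> (matrix_prod A n)" for c x n
  proof (cases "c = 0")
    case True
    then show ?thesis using W[of n] x by fastforce
  next
    case False
    then have c: "c > 0" using c by simp
    have "x / c \<le> b n" unfolding b_def
      by (rule cINF_greatest[OF W]) (use x c in \<open>simp add: field_simps\<close>)
    then show ?thesis using c by (simp add: field_simps)
  qed
  have sub: "b (m + n) \<le> b m * b n" for m n
  proof -
    have "b (m + n) \<le> b n * induced_norm \<nu> (matrix_prod A m)" if "A \<in> W m" for A
      using INF_scale[of "induced_norm \<nu> (matrix_prod A m)" n "b (m + n)"] le1[OF that]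
        induced_norm_nonneg[OF \<nu>] by (simp add: mult.commute)
    then show ?thesis using INF_scale[of "b n" m "b (m + n)"] b0 by (simp add: mult.commute)
  qed
  have root_eq: "inf_root_norm \<nu> S n = root n (b n)" if n: "n \<ge> 1" for n
  proof (rule antisym)
    define y where "y = inf_root_norm \<nu> S n"
    have bddr: "bdd_below ((\<lambda>A. root n (induced_norm \<nu> (matrix_prod A n))) ` W n)"
      by (rule bdd_belowI2[of _ 0]) (intro real_root_ge_zero induced_norm_nonneg[OF \<nu>])
    have y: "y = (INF A\<in>W n. root n (induced_norm \<nu> (matrix_prod A n)))"
      by (simp add: y_def inf_root_norm_def W_def)
    have y0: "0 \<le> y" unfolding y
      by (rule cINF_greatest[OF W]) (intro real_root_ge_zero induced_norm_nonneg[OF \<nu>])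
    have "y ^ n \<le> b n" unfolding b_def
    proof (rule cINF_greatest[OF W])
      fix A assume A: "A \<in> W n"
      have "y \<le> root n (induced_norm \<nu> (matrix_prod A n))" unfolding y by (rule cINF_lower[OF bddr A])
      then have "y ^ n \<le> root n (induced_norm \<nu> (matrix_prod A n)) ^ n"
        using y0 by (rule power_mono)
      then show "y ^ n \<le> induced_norm \<nu> (matrix_prod A n)"
        using n induced_norm_nonneg[OF \<nu>] by simp
    qed
    then have "root n (y ^ n) \<le> root n (b n)" using n by (intro real_root_le_mono) auto
    then show "inf_root_norm \<nu> S n \<le> root n (b n)"
      using n y0 real_root_power_cancel[of n y] unfolding y_def by linarith
    show "root n (b n) \<le> inf_root_norm \<nu> S n"
      unfolding y_def[symmetric] y
      by (rule cINF_greatest[OF W]) (use n bdd in \<open>auto simp: b_def intro: cINF_lower\<close>)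
  qed
  have "(\<lambda>n. root n (b n)) \<longlonglongrightarrow> (INF n\<in>{1..}. root n (b n))"
    using b0 sub by (rule submultiplicative_root_LIMSEQ)
  moreover have "(INF n\<in>{1..}. root n (b n)) = (INF n\<in>{1..}. inf_root_norm \<nu> S n)"
    using root_eq by (intro INF_cong) auto
  moreover have "\<forall>\<^sub>F n in sequentially. root n (b n) = inf_root_norm \<nu> S n"
    using eventually_ge_at_top[of 1] by eventually_elim (simp add: root_eq)
  ultimately show ?thesis using tendsto_cong by metis
qed

lemma lower_spectral_radius_eq_INF:
  fixes \<nu> :: "real ^ 'n \<Rightarrow> real"
  assumes "vector_norm \<nu>" and "S \<noteq> {}"
  shows "lower_spectral_radius \<nu> S = (INF n\<in>{1..}. inf_root_norm \<nu> S n)"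
  unfolding lower_spectral_radius_def by (rule limI[OF inf_root_norm_LIMSEQ[OF assms]])

end

theory Submission imports Defs begin

text \<open>
  The sum of the entries is linear in each factor of a matrix product, so replacing the factors
  one at a time shows that a product of matrices from the convex hull of \<open>\<A>\<close> has an entry sum at
  least that of some product of the same length from \<open>\<A>\<close>. On non-negative matrices the entry sum
  is comparable to any induced norm, and the constant disappears under the \<open>n\<close>-th root.
\<close>

definition entry_sum :: "real ^ 'n ^ 'm \<Rightarrow> real" where
  "entry_sum M = (\<Sum>i\<in>UNIV. \<Sum>j\<in>UNIV. M $ i $ j)"

text \<open>Here \<open>1\<close> is the all-ones vector; written as an inner product, the entry sum
  is open to Cauchy-Schwarz.\<close>

lemma entry_sum_eq_inner: "entry_sum M = 1 \<bullet> (M *v 1)"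
  by (simp add: entry_sum_def inner_vec_def matrix_vector_mult_def)

lemma linear_entry_sum_mult: "linear (\<lambda>M. entry_sum (X ** M ** Y))"
  by (rule linearI)
    (simp_all add: entry_sum_def matrix_matrix_mult_def sum.distrib sum_distrib_left
      sum_distrib_right algebra_simps)

text \<open>If \<open>f\<close> exceeded \<open>f x\<close> on all of \<open>S\<close>, the open
  half-space where \<open>f\<close> exceeds \<open>f x\<close> would be a convex set containing
  \<open>S\<close>, hence would contain the hull and \<open>x\<close> itself.\<close>

lemma convex_hull_linear_ge_member:
  fixes f :: "'a::real_vector \<Rightarrow> real"
  assumes "linear f" and x: "x \<in> convex hull S"
  obtains y where "y \<in> S" "f y \<le> f x"
proof (rule ccontr)
  assume "\<not> thesis"
  then have "S \<subseteq> f -` {f x<..}"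
    using that by force
  moreover have "convex (f -` {f x<..})"
    by (intro convex_linear_vimage assms(1) convex_real_interval)
  ultimately have "convex hull S \<subseteq> f -` {f x<..}"
    by (rule hull_minimal)
  with x show False by auto
qed

text \<open>The prefix \<open>X\<close> is arbitrary so that the induction can absorb replaced
  factors into it: the leftmost factor is exchanged first, with both sides of it frozen, and its
  substitute then joins \<open>X\<close> while the shorter product is treated.\<close>

lemma convex_hull_matrix_prod_entry_sum:
  assumes "\<forall>i\<in>{1..n}. A i \<in> convex hull S"
  shows "\<exists>B. (\<forall>i\<in>{1..n}. B i \<in> S) \<and>
    entry_sum (X ** matrix_prod B n) \<le> entry_sum (X ** matrix_prod A n)"
  using assms
proof (induction n arbitrary: X)
  case (Suc n)
  have "A (Suc n) \<in> convex hull S"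
    using Suc.prems by simp
  then obtain M where M: "M \<in> S"
    "entry_sum (X ** M ** matrix_prod A n) \<le> entry_sum (X ** A (Suc n) ** matrix_prod A n)"
    by (rule convex_hull_linear_ge_member[OF linear_entry_sum_mult])
  obtain B where B: "\<forall>i\<in>{1..n}. B i \<in> S"
    "entry_sum ((X ** M) ** matrix_prod B n) \<le> entry_sum ((X ** M) ** matrix_prod A n)"
    using Suc.IH[of "X ** M"] Suc.prems by auto
  have "matrix_prod (B(Suc n := M)) n = matrix_prod B n"
    by (rule matrix_prod_cong) auto
  then have "entry_sum (X ** matrix_prod (B(Suc n := M)) (Suc n))
      \<le> entry_sum (X ** matrix_prod A (Suc n))"
    using M(2) B(2) by (simp add: matrix_mul_assoc)
  moreover have "\<forall>i\<in>{1..Suc n}. (B(Suc n := M)) i \<in> S"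
    using B(1) M(1) by (auto simp: le_Suc_eq)
  ultimately show ?case by blast
qed simp

lemma matrix_prod_nonneg:
  assumes "\<And>k. k \<in> {1..n} \<Longrightarrow> \<forall>i j. 0 \<le> A k $ i $ j"
  shows "0 \<le> matrix_prod A n $ i $ j"
  using assms
proof (induction n arbitrary: i j)
  case (Suc n)
  then show ?case
    by (auto simp: matrix_matrix_mult_def intro!: sum_nonneg mult_nonneg_nonneg)
qed (simp add: mat_def)

text \<open>By Cauchy-Schwarz the entry sum is at most the norm of the all-ones vector times the
  norm of its image under \<open>M\<close>, and the induced norm controls that image.\<close>

lemma entry_sum_le_induced_norm:
  fixes \<nu> :: "real ^ 'n \<Rightarrow> real"
  assumes \<nu>: "vector_norm \<nu>"
  obtains K where "K > 0" "\<And>M. entry_sum M \<le> K * induced_norm \<nu> M"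
proof -
  obtain c C where cC: "c > 0" "C > 0" "\<And>x. c * norm x \<le> \<nu> x" "\<And>x. \<nu> x \<le> C * norm x"
    using vector_norm_bounds[OF \<nu>] by blast
  define u :: "real ^ 'n" where "u = 1"
  have u: "norm u > 0"
    by (simp add: u_def vec_eq_iff)
  show thesis
  proof (rule that)
    \<comment> \<open>The first \<open>norm u\<close> comes from Cauchy-Schwarz,
      \<open>C * norm u\<close> bounds \<open>\<nu> u\<close>, and \<open>1 / c\<close> converts
      \<open>\<nu>\<close> of the image back to the Euclidean norm.\<close>
    show "norm u * C * norm u / c > 0"
      using u cC by simp
    fix M :: "real ^ 'n ^ 'n"
    have "c * norm (M *v u) \<le> induced_norm \<nu> M * \<nu> u"
      using cC(3) induced_norm_le[OF \<nu>] order_trans by blast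
    also have "\<dots> \<le> induced_norm \<nu> M * (C * norm u)"
      by (intro mult_left_mono cC(4) induced_norm_nonneg[OF \<nu>])
    finally have "norm (M *v u) \<le> induced_norm \<nu> M * (C * norm u) / c"
      using cC(1) by (simp add: field_simps)
    then have "norm u * norm (M *v u) \<le> norm u * (induced_norm \<nu> M * (C * norm u) / c)"
      by (intro mult_left_mono) auto
    moreover have "entry_sum M \<le> norm u * norm (M *v u)"
      unfolding entry_sum_eq_inner u_def by (rule norm_cauchy_schwarz)
    ultimately show "entry_sum M \<le> norm u * C * norm u / c * induced_norm \<nu> M"
      by (simp add: mult_ac)
  qed
qed

text \<open>Pass to the sum of absolute values of the coordinates; non-negativity lets the entries
  stand for their own absolute values.\<close>

lemma norm_matrix_vector_le_entry_sum:
  assumes nonneg: "\<And>i j. 0 \<le> M $ i $ j"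
  shows "norm (M *v x) \<le> entry_sum M * norm x"
proof -
  have "norm (M *v x) \<le> (\<Sum>i\<in>UNIV. \<bar>(M *v x) $ i\<bar>)"
    by (rule norm_le_l1_cart)
  also have "\<dots> \<le> (\<Sum>i\<in>UNIV. \<Sum>j\<in>UNIV. M $ i $ j * norm x)"
  proof (rule sum_mono)
    fix i
    have "\<bar>(M *v x) $ i\<bar> \<le> (\<Sum>j\<in>UNIV. \<bar>M $ i $ j * x $ j\<bar>)"
      by (simp add: matrix_vector_mult_def)
    also have "\<dots> \<le> (\<Sum>j\<in>UNIV. M $ i $ j * norm x)"
      by (intro sum_mono) (simp add: abs_mult nonneg component_le_norm_cart mult_left_mono)
    finally show "\<bar>(M *v x) $ i\<bar> \<le> (\<Sum>j\<in>UNIV. M $ i $ j * norm x)" .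
  qed
  finally show ?thesis
    by (simp add: entry_sum_def sum_distrib_right)
qed

text \<open>In this direction non-negativity rules out cancellation, which could make the entry sum
  of a nonzero matrix vanish.\<close>

lemma induced_norm_le_entry_sum:
  fixes \<nu> :: "real ^ 'n \<Rightarrow> real"
  assumes \<nu>: "vector_norm \<nu>"
  obtains K where "K > 0"
    "\<And>M. (\<And>i j. 0 \<le> M $ i $ j) \<Longrightarrow> induced_norm \<nu> M \<le> K * entry_sum M"
proof -
  obtain c C where cC: "c > 0" "C > 0" "\<And>x. c * norm x \<le> \<nu> x" "\<And>x. \<nu> x \<le> C * norm x"
    using vector_norm_bounds[OF \<nu>] by blast
  show thesis
  proof (rule that)
    show "C / c > 0"
      using cC by simp
    fix M :: "real ^ 'n ^ 'n"
    assume nonneg: "\<And>i j. 0 \<le> M $ i $ j"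
    show "induced_norm \<nu> M \<le> C / c * entry_sum M"
      unfolding induced_norm_def
    proof (rule cSUP_least)
      show "{x :: real ^ 'n. x \<noteq> 0} \<noteq> {}"
        using axis_eq_0_iff[of undefined "1::real"] by fastforce
      fix x :: "real ^ 'n"
      assume "x \<in> {x. x \<noteq> 0}"
      then have "0 < c * norm x"
        using cC(1) by simp
      then have pos: "0 < \<nu> x"
        using cC(3)[of x] by linarith
      have "0 \<le> entry_sum M"
        by (simp add: entry_sum_def nonneg sum_nonneg)
      moreover have "norm x \<le> \<nu> x / c"
        using cC(1) cC(3)[of x] by (simp add: field_simps)
      ultimately have "norm (M *v x) \<le> entry_sum M * (\<nu> x / c)"
        using norm_matrix_vector_le_entry_sum[OF nonneg] by (meson mult_left_mono order_trans)
      then have "C * norm (M *v x) \<le> C * (entry_sum M * (\<nu> x / c))"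
        using cC(2) by (intro mult_left_mono) auto
      then have "\<nu> (M *v x) \<le> C / c * entry_sum M * \<nu> x"
        using cC(4)[of "M *v x"] by (simp add: mult_ac)
      then show "\<nu> (M *v x) / \<nu> x \<le> C / c * entry_sum M"
        using pos by (simp add: field_simps)
    qed
  qed
qed

lemma inf_root_norm_lower:
  assumes "vector_norm \<nu>" and "\<forall>i\<in>{1..n}. A i \<in> S"
  shows "inf_root_norm \<nu> S n \<le> root n (induced_norm \<nu> (matrix_prod A n))"
  unfolding inf_root_norm_def
  by (rule cINF_lower[OF bdd_belowI2[of _ 0]])
    (use assms in \<open>auto intro: real_root_ge_zero induced_norm_nonneg\<close>)

lemma inf_root_norm_greatest:
  assumes "S \<noteq> {}"
    and "\<And>A. \<forall>i\<in>{1..n}. A i \<in> S \<Longrightarrow> x \<le> root n (induced_norm \<nu> (matrix_prod A n))"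
  shows "x \<le> inf_root_norm \<nu> S n"
proof -
  have "{A. \<forall>i\<in>{1..n}. A i \<in> S} \<noteq> {}"
    using assms(1) by (auto intro!: exI[of _ "\<lambda>_. SOME M. M \<in> S"] simp: some_in_eq)
  then show ?thesis
    unfolding inf_root_norm_def using assms(2) by (intro cINF_greatest) auto
qed

lemma lower_spectral_radius_LIMSEQ:
  assumes "vector_norm \<nu>" and "S \<noteq> {}"
  shows "inf_root_norm \<nu> S \<longlonglongrightarrow> lower_spectral_radius \<nu> S"
  using inf_root_norm_LIMSEQ[OF assms] lower_spectral_radius_eq_INF[OF assms] by simp

theorem theorem4:
  fixes \<A> :: "(real ^ 'n ^ 'n) set" and \<nu> :: "real ^ 'n \<Rightarrow> real"
  assumes "vector_norm \<nu>"
    and "\<A> \<noteq> {}"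
    and "bounded \<A>"
    and "\<And>A i j. A \<in> \<A> \<Longrightarrow> 0 \<le> A $ i $ j"
  shows "lower_spectral_radius \<nu> \<A> = lower_spectral_radius \<nu> (convex hull \<A>)"
proof (rule antisym)
  note \<nu> = assms(1) and ne = assms(2) and nonneg = assms(4)
  have hull_ne: "convex hull \<A> \<noteq> {}"
    using ne by simp
  note lim = lower_spectral_radius_LIMSEQ[OF \<nu> ne] lower_spectral_radius_LIMSEQ[OF \<nu> hull_ne]
  \<comment> \<open>The easy inequality: every product over \<open>\<A>\<close> is also a product
    over its hull.\<close>
  have "inf_root_norm \<nu> (convex hull \<A>) n \<le> inf_root_norm \<nu> \<A> n" for n
    by (intro inf_root_norm_greatest ne inf_root_norm_lower \<nu>) (simp add: hull_inc)
  then show "lower_spectral_radius \<nu> (convex hull \<A>) \<le> lower_spectral_radius \<nu> \<A>"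
    by (intro LIMSEQ_le[OF lim(2,1)]) blast
  obtain K where K: "K > 0" "\<And>M. entry_sum M \<le> K * induced_norm \<nu> M"
    using entry_sum_le_induced_norm[OF \<nu>] by blast
  obtain L where L: "L > 0"
    "\<And>M. (\<And>i j. 0 \<le> M $ i $ j) \<Longrightarrow> induced_norm \<nu> M \<le> L * entry_sum M"
    using induced_norm_le_entry_sum[OF \<nu>] by blast
  \<comment> \<open>For \<open>n \<ge> 1\<close> the divisor is positive and \<open>root n\<close>
    is monotone, whereas \<open>root 0\<close> is constantly 0.\<close>
  have bound: "inf_root_norm \<nu> \<A> n / root n (L * K) \<le> inf_root_norm \<nu> (convex hull \<A>) n"
    if n: "n \<ge> 1" for n
  proof (rule inf_root_norm_greatest[OF hull_ne])
    fix A :: "nat \<Rightarrow> real ^ 'n ^ 'n"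
    assume "\<forall>i\<in>{1..n}. A i \<in> convex hull \<A>"
    from convex_hull_matrix_prod_entry_sum[OF this, of "mat 1"]
    obtain B where B: "\<forall>i\<in>{1..n}. B i \<in> \<A>"
      "entry_sum (matrix_prod B n) \<le> entry_sum (matrix_prod A n)"
      by auto
    \<comment> \<open>The factors \<open>B i\<close> lie in \<open>\<A>\<close>, so their product is
      non-negative and \<open>L\<close> applies to it; \<open>K\<close> then returns from the entry
      sum to the norm of the hull product.\<close>
    have "induced_norm \<nu> (matrix_prod B n) \<le> L * entry_sum (matrix_prod B n)"
      using B(1) nonneg by (intro L(2) matrix_prod_nonneg) blast
    also have "\<dots> \<le> L * (K * induced_norm \<nu> (matrix_prod A n))"
      using B(2) K(2)[of "matrix_prod A n"] L(1) by (intro mult_left_mono) auto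
    finally have "root n (induced_norm \<nu> (matrix_prod B n))
        \<le> root n (L * K * induced_norm \<nu> (matrix_prod A n))"
      using n by (simp add: mult.assoc)
    then have "inf_root_norm \<nu> \<A> n \<le> root n (L * K) * root n (induced_norm \<nu> (matrix_prod A n))"
      using inf_root_norm_lower[OF \<nu> B(1)] by (simp add: real_root_mult)
    moreover have "root n (L * K) > 0"
      using K(1) L(1) n by (intro real_root_gt_zero) auto
    ultimately show "inf_root_norm \<nu> \<A> n / root n (L * K)
        \<le> root n (induced_norm \<nu> (matrix_prod A n))"
      by (simp add: field_simps)
  qed
  \<comment> \<open>The \<open>n\<close>-th root of the positive constant \<open>L * K\<close> tends
    to 1, so \<open>bound\<close> loses its factor in the limit.\<close>
  have "(\<lambda>n. inf_root_norm \<nu> \<A> n / root n (L * K)) \<longlonglongrightarrow> lower_spectral_radius \<nu> \<A> / 1"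
    using K(1) L(1) by (intro tendsto_divide lim(1) LIMSEQ_root_const) auto
  then show "lower_spectral_radius \<nu> \<A> \<le> lower_spectral_radius \<nu> (convex hull \<A>)"
    using LIMSEQ_le[OF _ lim(2)] bound by auto
qed

end
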